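(* Let $\Delta t>0$ and let $x^m_h, x^{m+\frac12}_h, z^{m+\frac12}_h\in\underline{V}^h$ be given. Assume that $|x^{m+\frac12}_{h,\rho}|>0$ in $I$ (i.e. the constant vector $x^{m+\frac12}_{h,\rho}|_{I_j}$ is nonzero for every $j=1,\ldots,J$). Then there exists a unique pair $(x^{m+1}_h,y^{m+\frac12}_h)\in\underline{V}^h\times\underline{V}^h$ such that $$\left( \frac{x^{m+1}_h-x^m_h}{\Delta t} , \chi_h |x^{m+\frac12}_{h,\rho}|^2 \right) - \left( y^{m+\frac12}_{h,\rho} , \chi_{h,\rho} \right) = 2 \left( (y^{m+\frac12}_{h,\rho} \cdot x^{m+\frac12}_{h,\rho}) z^{m+\frac12}_h , \chi_h \right) + \left( (z^{m+\frac12}_h \cdot y^{m+\frac12}_h) z^{m+\frac12}_h , \chi_h | x^{m+\frac12}_{h,\rho} |^2 \right) + \left( F_2(x^{m+\frac12}_{h,\rho},z^{m+\frac12}_h,z^{m+\frac12}_{h,\rho})\,y^{m+\frac12}_h , \chi_h \right)$$ for all $\chi_h\in\underline{V}^h$, and $$\left( y^{m+\frac12}_h , \eta_h |x^{m+\frac12}_{h,\rho}|^2 \right) + \tfrac12\left( x^{m+1}_{h,\rho} , \eta_{h,\rho} \right) = - \tfrac12\left( x^{m}_{h,\rho} , \eta_{h,\rho} \right)$$ for all $\eta_h\in\underline{V}^h$. Moreover, this solution satisfies the stability estimate $$\tfrac12 |x^{m+1}_h|^2_1 + \Delta t \left( \left| y^{m+\frac12}_{h,\rho} + (z^{m+\frac12}_h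 \cdot y^{m+\frac12}_h) x^{m+\frac12}_{h,\rho} \right|^2, 1 \right) = \tfrac12 |x^m_h|^2_1.$$
   Context: Let $d\ge 2$ and let $I=\mathbb{R}/\mathbb{Z}$ be the periodic unit interval. Let $[0,1]=\bigcup_{j=1}^J I_j$, $J\ge 3$, be a decomposition into intervals $I_j=[\rho_{j-1},\rho_j]$, where $0=\rho_0<\rho_1<\dots<\rho_J=1$, with $\rho_0$ and $\rho_J$ identified by periodicity. Let $h_j=\rho_j-\rho_{j-1}$ and $h=\max_{1\le j\le J}h_j$. (Throughout it is assumed that $|h_j-h_{j-1}|\le c h^2$ and $h\le c h_j$ for $j=1,\ldots,J$, with indices understood periodically and $c$ a constant independent of $h$.) Finite element spaces: $V^h=\{\chi\in C^0(I): \chi|_{I_j}\text{ is affine},\ j=1,\ldots,J\}$ and $\underline{V}^h=[V^h]^d$. A subscript $\rho$ denotes differentiation with respect to $\rho\in I$. $(\cdot,\cdot)$ denotes the (exact) $L^2$-inner product on $I$ and $|u|_1=\left(\int_I|u_\rho|^2\,d\rho\right)^{1/2}$ is the $H^1(I)$-seminorm. $|\cdot|$ denotes the Euclidean norm in $\mathbb{R}^d$. For $a,b,c\in\mathbb{R}^d$, the matrix $F_2(a,b,c)\in\mathbb{R}^{d\times d}$ is defined by $$F_2(a,b,c)=2\bigl(c\otimes a-a\otimes c\bigr)+2(a\cdot b)\bigl(a\otimes b-b\otimes a\bigr),$$ where $(u\otimes v)w=(v\cdot w)u$ for $u,v,w\in\mathbb{R}^d$. The functions $x^{m+\frac12}_h,z^{m+\frac12}_h$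 play the role of predictor variables; the result holds regardless of how they are obtained. *)

theory Defs
  imports "HOL-Analysis.Analysis"
begin

text \<open>
  Functions on the periodic interval \<open>I = \<real>/\<int>\<close> are represented by the functions
  on \<open>\<real>\<close> of period 1.  A mesh of \<open>[0,1]\<close> with \<open>J\<close> elements is given by its nodes
  \<open>\<rho> 0, \<dots>, \<rho> J\<close>; values of \<open>\<rho>\<close> beyond \<open>J\<close> play no role.
\<close>

definition mesh :: "nat \<Rightarrow> (nat \<Rightarrow> real) \<Rightarrow> bool" where
  "mesh J \<rho> \<longleftrightarrow> \<rho> 0 = 0 \<and> \<rho> J = 1 \<and> (\<forall>j\<in>{1..J}. \<rho> (j - 1) < \<rho> j)"

text \<open>The index \<open>0\<close> is identified with \<open>J\<close>, by periodicity.\<close>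

definition elem_length :: "nat \<Rightarrow> (nat \<Rightarrow> real) \<Rightarrow> nat \<Rightarrow> real" where
  "elem_length J \<rho> j = (if j = 0 then \<rho> J - \<rho> (J - 1) else \<rho> j - \<rho> (j - 1))"

definition mesh_size :: "nat \<Rightarrow> (nat \<Rightarrow> real) \<Rightarrow> real" where
  "mesh_size J \<rho> = Max (elem_length J \<rho> ` {1..J})"

definition mesh_regular :: "real \<Rightarrow> nat \<Rightarrow> (nat \<Rightarrow> real) \<Rightarrow> bool" where
  "mesh_regular c J \<rho> \<longleftrightarrow>
     (\<forall>j\<in>{1..J}. \<bar>elem_length J \<rho> j - elem_length J \<rho> (j - 1)\<bar> \<le> c * (mesh_size J \<rho>)\<^sup>2
               \<and> mesh_size J \<rho> \<le> c * elem_length J \<rho> j)"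

definition Vh :: "nat \<Rightarrow> (nat \<Rightarrow> real) \<Rightarrow> (real \<Rightarrow> real) set" where
  "Vh J \<rho> = {\<phi>. continuous_on UNIV \<phi> \<and> (\<forall>s. \<phi> (s + 1) = \<phi> s) \<and>
                 (\<forall>j\<in>{1..J}. \<exists>a b. \<forall>s\<in>{\<rho> (j - 1)..\<rho> j}. \<phi> s = a * s + b)}"

definition Vh_vec :: "nat \<Rightarrow> (nat \<Rightarrow> real) \<Rightarrow> (real \<Rightarrow> real ^ 'n) set" where
  "Vh_vec J \<rho> = {\<phi>. \<forall>i. (\<lambda>s. \<phi> s $ i) \<in> Vh J \<rho>}"

text \<open>
  For finite element functions \<open>drho f\<close> is the derivative inside each element; its value at
  a node where \<open>f\<close> has a kink is unspecified, which does not affect the integrals below.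
\<close>

definition drho :: "(real \<Rightarrow> 'a::real_normed_vector) \<Rightarrow> real \<Rightarrow> 'a" where
  "drho f s = vector_derivative f (at s)"

definition L2_inner :: "(real \<Rightarrow> 'a::real_inner) \<Rightarrow> (real \<Rightarrow> 'a) \<Rightarrow> real" where
  "L2_inner f g = integral {0..1} (\<lambda>s. f s \<bullet> g s)"

definition H1_seminorm :: "(real \<Rightarrow> 'a::real_normed_vector) \<Rightarrow> real" where
  "H1_seminorm u = sqrt (integral {0..1} (\<lambda>s. (norm (drho u s))\<^sup>2))"

definition outer :: "real ^ 'n \<Rightarrow> real ^ 'n \<Rightarrow> real ^ 'n ^ 'n" where
  "outer u v = matrix (\<lambda>w. (v \<bullet> w) *\<^sub>R u)"

lemma outer_mult_vec: "outer u v *v w = (v \<bullet> w) *\<^sub>R u"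
proof -
  have "linear (\<lambda>w. (v \<bullet> w) *\<^sub>R u)"
    by (rule linearI) (simp_all add: inner_add_right scaleR_add_left)
  then show ?thesis by (simp add: outer_def)
qed

definition F2 :: "real ^ 'n \<Rightarrow> real ^ 'n \<Rightarrow> real ^ 'n \<Rightarrow> real ^ 'n ^ 'n" where
  "F2 a b c = 2 *\<^sub>R (outer c a - outer a c) + (2 * (a \<bullet> b)) *\<^sub>R (outer a b - outer b a)"

text \<open>
  \<open>xm\<close>, \<open>xh\<close>, \<open>zh\<close> are the data \<open>x\<^sup>m\<close>, \<open>x\<^bsup>m+1/2\<^esup>\<close>, \<open>z\<^bsup>m+1/2\<^esup>\<close>, and \<open>xn\<close>, \<open>yh\<close> are the
  unknowns \<open>x\<^bsup>m+1\<^esup>\<close>, \<open>y\<^bsup>m+1/2\<^esup>\<close>.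
\<close>

definition scheme_solution ::
  "nat \<Rightarrow> (nat \<Rightarrow> real) \<Rightarrow> real \<Rightarrow> (real \<Rightarrow> real ^ 'n) \<Rightarrow> (real \<Rightarrow> real ^ 'n) \<Rightarrow>
   (real \<Rightarrow> real ^ 'n) \<Rightarrow> (real \<Rightarrow> real ^ 'n) \<Rightarrow> (real \<Rightarrow> real ^ 'n) \<Rightarrow> bool" where
  "scheme_solution J \<rho> \<Delta>t xm xh zh xn yh \<longleftrightarrow>
     xn \<in> Vh_vec J \<rho> \<and> yh \<in> Vh_vec J \<rho> \<and>
     (\<forall>\<phi>\<in>Vh_vec J \<rho>.
        L2_inner (\<lambda>s. (1 / \<Delta>t) *\<^sub>R (xn s - xm s)) (\<lambda>s. (norm (drho xh s))\<^sup>2 *\<^sub>R \<phi> s)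
          - L2_inner (drho yh) (drho \<phi>)
        = 2 * L2_inner (\<lambda>s. (drho yh s \<bullet> drho xh s) *\<^sub>R zh s) \<phi>
          + L2_inner (\<lambda>s. (zh s \<bullet> yh s) *\<^sub>R zh s) (\<lambda>s. (norm (drho xh s))\<^sup>2 *\<^sub>R \<phi> s)
          + L2_inner (\<lambda>s. F2 (drho xh s) (zh s) (drho zh s) *v yh s) \<phi>) \<and>
     (\<forall>\<eta>\<in>Vh_vec J \<rho>.
        L2_inner yh (\<lambda>s. (norm (drho xh s))\<^sup>2 *\<^sub>R \<eta> s) + 1/2 * L2_inner (drho xn) (drho \<eta>)
        = - (1/2) * L2_inner (drho xm) (drho \<eta>))"

end

theory Submission
  imports Defs "HOL-Library.Function_Algebras"
begin

text \<open>
  The scheme is a square linear system for the pair \<open>(X, Y) = (x\<^bsup>m+1\<^esup>, y\<^bsup>m+1/2\<^esup>)\<close>: trial and test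
  functions range over the same finite-dimensional space \<open>V \<times> V\<close>.  Existence and uniqueness
  both reduce to showing that the homogeneous problem has only the trivial solution, and this
  follows from the stability identity itself.

  Write \<open>x\<close> and \<open>z\<close> for the predictors.  Test the first equation with \<open>Y\<close>.  The matrix \<open>F\<^sub>2\<close>
  is antisymmetric, so its term vanishes, and the remaining terms complete the square
  \<open>|Y\<^sub>\<rho>|\<^sup>2 + 2 (Y\<^sub>\<rho> \<bullet> x\<^sub>\<rho>) (z \<bullet> Y) + (z \<bullet> Y)\<^sup>2 |x\<^sub>\<rho>|\<^sup>2 = |Y\<^sub>\<rho> + (z \<bullet> Y) x\<^sub>\<rho>|\<^sup>2\<close>.
  Testing the second equation with \<open>X - x\<^sup>m\<close> shows that the difference quotient in the first
  contributes \<open>(|x\<^sup>m|\<^sub>1\<^sup>2 - |X|\<^sub>1\<^sup>2) / (2 \<Delta>t)\<close>.  This is lemma \<open>energy_identity\<close>.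

  A solution of the homogeneous problem is a solution for \<open>x\<^sup>m = 0\<close>, so the identity gives
  \<open>X\<^sub>\<rho> = 0\<close>.  The second equation tested with \<open>Y\<close> then says that the integral of
  \<open>|x\<^sub>\<rho>|\<^sup>2 |Y|\<^sup>2\<close> vanishes, so \<open>Y = 0\<close> because \<open>x\<^sub>\<rho>\<close> has no zero inside an element; now the first
  equation tested with \<open>X\<close> gives \<open>X = 0\<close>.  This is lemma \<open>scheme_form_nondegenerate\<close>.

  The dimension of \<open>V\<close> depends on the number of elements and so cannot be a type.  The space of
  all functions is therefore made a real vector space, \<open>V \<times> V\<close> is a subspace of it on which the
  nodal values are injective, and lemma \<open>nondegenerate_form_solvable\<close> carries out the passage
  from injectivity to surjectivity.
\<close>

section \<open>Solvability of finite-dimensional linear problems\<close>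

text \<open>
  With the pointwise vector space structure the notions \<open>subspace\<close>, \<open>span\<close> and \<open>independent\<close>
  apply to finite element functions, and also to coordinate vectors indexed by a finite set
  that is not a type.
\<close>

instantiation "fun" :: (type, real_vector) real_vector
begin

definition scaleR_fun :: "real \<Rightarrow> ('a \<Rightarrow> 'b) \<Rightarrow> 'a \<Rightarrow> 'b" where
  "scaleR_fun r f = (\<lambda>x. r *\<^sub>R f x)"

instance
  by standard (auto simp: scaleR_fun_def fun_eq_iff algebra_simps)

end

lemma scaleR_fun_apply [simp]: "(r *\<^sub>R f) x = r *\<^sub>R f x"
  by (simp add: scaleR_fun_def)

lemma supported_functions_finite_dimensional:
  fixes K :: "'k set"
  assumes "finite K"
  obtains S :: "('k \<Rightarrow> 'b::euclidean_space) set"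
  where "finite S" "card S \<le> card K * DIM('b)"
    "\<And>g. (\<And>k. k \<notin> K \<Longrightarrow> g k = 0) \<Longrightarrow> g \<in> span S"
proof
  define e :: "'k \<times> 'b \<Rightarrow> 'k \<Rightarrow> 'b" where "e = (\<lambda>(k, b) j. if j = k then b else 0)"
  let ?S = "e ` (K \<times> Basis)"
  show "finite ?S" using assms by simp
  show "card ?S \<le> card K * DIM('b)"
    using card_image_le[of "K \<times> (Basis :: 'b set)" e] assms by (simp add: card_cartesian_product)
  fix g :: "'k \<Rightarrow> 'b" assume g: "\<And>k. k \<notin> K \<Longrightarrow> g k = 0"
  have sum_apply: "(\<Sum>i\<in>A. f i) j = (\<Sum>i\<in>A. f i j)" for A :: "('k \<times> 'b) set" and f :: "'k \<times> 'b \<Rightarrow> 'k \<Rightarrow> 'b" and j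
    by (induction A rule: infinite_finite_induct) auto
  have "g = (\<Sum>p\<in>K \<times> Basis. (g (fst p) \<bullet> snd p) *\<^sub>R e p)"
  proof
    fix j
    have "(\<Sum>p\<in>K \<times> Basis. (g (fst p) \<bullet> snd p) *\<^sub>R e p) j
        = (\<Sum>k\<in>K. \<Sum>b\<in>Basis. (g k \<bullet> b) *\<^sub>R (if j = k then b else 0))"
      by (simp add: sum_apply sum.cartesian_product e_def case_prod_unfold)
    also have "\<dots> = (\<Sum>k\<in>K. if j = k then g k else 0)"
      by (intro sum.cong refl) (simp add: euclidean_representation)
    also have "\<dots> = g j" using assms g by (simp add: sum.delta')
    finally show "g j = (\<Sum>p\<in>K \<times> Basis. (g (fst p) \<bullet> snd p) *\<^sub>R e p) j" ..
  qed
  also have "\<dots> \<in> span ?S"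
    by (intro span_sum span_scale span_base imageI)
  finally show "g \<in> span ?S" .
qed

text \<open>
  The map \<open>E\<close> should be read as evaluation at finitely many points: a linear injection on \<open>W\<close>
  sends an independent set to an independent set of finitely supported functions, which bounds
  its size.
\<close>

lemma finite_basis_if_separated:
  fixes E :: "'a::real_vector \<Rightarrow> 'k \<Rightarrow> 'b::euclidean_space"
  assumes W: "subspace W" and K: "finite K" and E: "linear E"
    and supp: "\<And>u k. k \<notin> K \<Longrightarrow> E u k = 0"
    and sep: "\<And>u. u \<in> W \<Longrightarrow> E u = 0 \<Longrightarrow> u = 0"
  obtains B where "finite B" "independent B" "span B = W"
proof -
  obtain B where B: "B \<subseteq> W" "independent B" "W \<subseteq> span B"
    using maximal_independent_subset by blast
  have eq: "span B = W"
    using B W by (metis span_minimal subset_antisym)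
  obtain S :: "('k \<Rightarrow> 'b) set" where S: "finite S" "\<And>g. (\<And>k. k \<notin> K \<Longrightarrow> g k = 0) \<Longrightarrow> g \<in> span S"
    using supported_functions_finite_dimensional[OF K] by metis
  have inj: "inj_on E (span B)"
    using linear_inj_on_iff_eq_0[OF E subspace_span] sep eq by blast
  have "independent (E ` B)"
    using linear_independent_injective_image[OF E B(2) inj] .
  moreover have "E ` B \<subseteq> span S" using S(2) supp by blast
  ultimately have "finite (E ` B)" using independent_span_bound S(1) by blast
  then have "finite B"
    using inj_on_subset[OF inj span_superset] by (simp add: finite_image_iff)
  then show ?thesis using that B eq by blast
qed

text \<open>
  Send \<open>u\<close> to the list of values \<open>a u b\<close> on the basis vectors \<open>b\<close>.  Nondegeneracy makes this map
  injective, and it goes into a space whose dimension is at most \<open>card B\<close>; so it is onto, and the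
  values of \<open>l\<close> on the basis are attained.  Bilinearity is required on \<open>W\<close> only, since the forms
  defined by integrals are not bilinear on arbitrary functions.
\<close>

lemma nondegenerate_form_solvable:
  fixes a :: "'a::real_vector \<Rightarrow> 'a \<Rightarrow> real"
  assumes B: "finite B" "independent B" "span B = W"
    and add_left: "\<And>u u' v. \<lbrakk>u \<in> W; u' \<in> W; v \<in> W\<rbrakk> \<Longrightarrow> a (u + u') v = a u v + a u' v"
    and scale_left: "\<And>r u v. \<lbrakk>u \<in> W; v \<in> W\<rbrakk> \<Longrightarrow> a (r *\<^sub>R u) v = r * a u v"
    and add_right: "\<And>u v v'. \<lbrakk>u \<in> W; v \<in> W; v' \<in> W\<rbrakk> \<Longrightarrow> a u (v + v') = a u v + a u v'"
    and scale_right: "\<And>r u v. \<lbrakk>u \<in> W; v \<in> W\<rbrakk> \<Longrightarrow> a u (r *\<^sub>R v) = r * a u v"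
    and l_add: "\<And>v v'. \<lbrakk>v \<in> W; v' \<in> W\<rbrakk> \<Longrightarrow> l (v + v') = l v + l v'"
    and l_scale: "\<And>r v. v \<in> W \<Longrightarrow> l (r *\<^sub>R v) = r * l v"
    and nondeg: "\<And>u. u \<in> W \<Longrightarrow> (\<And>v. v \<in> W \<Longrightarrow> a u v = 0) \<Longrightarrow> u = 0"
  shows "\<exists>u\<in>W. \<forall>v\<in>W. a u v = l v"
proof -
  have W: "subspace W" using B(3) subspace_span by blast
  have BW: "b \<in> W" if "b \<in> B" for b using that B(3) span_base by blast
  \<comment> \<open>A linear functional is determined by its values on the basis; this is applied with \<open>m = 0\<close>
    and with \<open>m = l\<close>.\<close>
  have agree: "a u v = m v"
    if u: "u \<in> W" and v: "v \<in> W" and on_B: "\<And>b. b \<in> B \<Longrightarrow> a u b = m b"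
      and m_add: "\<And>v v'. \<lbrakk>v \<in> W; v' \<in> W\<rbrakk> \<Longrightarrow> m (v + v') = m v + m v'"
      and m_scale: "\<And>r v. v \<in> W \<Longrightarrow> m (r *\<^sub>R v) = r * m v" for u v m
  proof -
    have "subspace {v \<in> W. a u v = m v}"
      using W u m_scale[of 0 0] scale_right[of u 0 0]
      by (auto simp: subspace_def add_right scale_right m_add m_scale)
    then have "span B \<subseteq> {v \<in> W. a u v = m v}"
      by (rule span_minimal[rotated]) (use BW on_B in auto)
    then show ?thesis using v B(3) by auto
  qed
  define R where "R m = (\<lambda>v. if v \<in> B then m v else 0)" for m :: "'a \<Rightarrow> real"
  \<comment> \<open>\<open>u \<mapsto> R (a u)\<close> is linear on \<open>W\<close> only; \<open>T\<close> is a linear map on the whole space that agrees with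
    it on \<open>B\<close> and hence on \<open>W\<close>.\<close>
  obtain T where T: "linear T" "\<And>b. b \<in> B \<Longrightarrow> T b = R (a b)"
    using linear_independent_extend[OF B(2), of "\<lambda>b. R (a b)"] by blast
  have T_eq: "T u = R (a u)" if "u \<in> W" for u
  proof -
    have "subspace {u \<in> W. T u = R (a u)}"
      using W scale_left[of 0 _ 0]
      by (auto simp: subspace_def linear_add[OF T(1)] linear_scale[OF T(1)] linear_0[OF T(1)]
          R_def fun_eq_iff add_left scale_left BW)
    then have "span B \<subseteq> {u \<in> W. T u = R (a u)}"
      by (rule span_minimal[rotated]) (use BW T(2) in auto)
    then show ?thesis using that B(3) by auto
  qed
  have inj: "inj_on T (span B)"
    unfolding linear_inj_on_iff_eq_0[OF T(1) subspace_span]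
  proof (intro ballI impI)
    fix u assume u: "u \<in> span B" "T u = 0"
    then have "a u b = 0" if "b \<in> B" for b
      using T_eq[of u] B(3) that by (auto simp: R_def fun_eq_iff split: if_splits)
    then have "a u v = 0" if "v \<in> W" for v
      using agree[of u v "\<lambda>_. 0"] u(1) B(3) that by simp
    then show "u = 0" using nondeg u(1) B(3) by blast
  qed
  have ind: "independent (T ` B)"
    using linear_independent_injective_image[OF T(1) B(2) inj] .
  have card: "card (T ` B) = card B"
    using card_image[OF inj_on_subset[OF inj span_superset]] .
  obtain S :: "('a \<Rightarrow> real) set" where S: "finite S" "card S \<le> card B"
      "\<And>g. (\<And>k. k \<notin> B \<Longrightarrow> g k = 0) \<Longrightarrow> g \<in> span S"
    using supported_functions_finite_dimensional[where 'b=real, OF B(1)] by (metis DIM_real mult_1_right)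
  \<comment> \<open>Otherwise \<open>R l\<close> could be added to the independent set \<open>T ` B\<close>, which would then have more
    elements than the space of functions supported on \<open>B\<close> allows.\<close>
  have "R l \<in> span (T ` B)"
  proof (rule ccontr)
    assume out: "R l \<notin> span (T ` B)"
    then have "independent (insert (R l) (T ` B))"
      using ind independent_insertI by blast
    moreover have "insert (R l) (T ` B) \<subseteq> span S"
      using S(3) T(2) by (auto simp: R_def)
    ultimately have "card (insert (R l) (T ` B)) \<le> card S"
      using independent_span_bound[OF S(1)] by blast
    moreover have "R l \<notin> T ` B" using out by (metis span_base)
    ultimately show False using card S(2) B(1) by simp
  qed
  then obtain u where u: "u \<in> W" "T u = R l"
    using linear_span_image[OF T(1), of B] B(3) by auto
  then have "a u b = l b" if "b \<in> B" for b
    using T_eq[of u] that by (auto simp: R_def fun_eq_iff split: if_splits)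
  then have "\<forall>v\<in>W. a u v = l v"
    using agree[of u _ l] u(1) l_add l_scale by blast
  then show ?thesis using u(1) by blast
qed

section \<open>Piecewise continuous functions on a mesh\<close>

text \<open>
  The class of all integrands that occur: on each element \<open>f\<close> agrees with a function continuous up
  to the end points, and the values of \<open>f\<close> at the nodes are arbitrary.  The latter is needed for
  derivatives of finite element functions, which are unspecified at the nodes.
\<close>

definition pw_cont :: "nat \<Rightarrow> (nat \<Rightarrow> real) \<Rightarrow> (real \<Rightarrow> 'a::topological_space) \<Rightarrow> bool" where
  "pw_cont J \<rho> f \<longleftrightarrow> (\<forall>j\<in>{1..J}. \<exists>g. continuous_on {\<rho> (j - 1)..\<rho> j} g \<and>
                        (\<forall>s\<in>{\<rho> (j - 1)<..<\<rho> j}. f s = g s))"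

lemma pw_cont_continuous: "continuous_on UNIV f \<Longrightarrow> pw_cont J \<rho> f"
  unfolding pw_cont_def by (auto intro!: exI[of _ f] elim: continuous_on_subset)

lemma pw_cont_compose:
  assumes "pw_cont J \<rho> f" "continuous_on UNIV h"
  shows "pw_cont J \<rho> (\<lambda>s. h (f s))"
  unfolding pw_cont_def
proof
  fix j assume "j \<in> {1..J}"
  then obtain g where g: "continuous_on {\<rho> (j - 1)..\<rho> j} g"
      "\<And>s. s \<in> {\<rho> (j - 1)<..<\<rho> j} \<Longrightarrow> f s = g s"
    using assms(1) unfolding pw_cont_def by metis
  have "continuous_on {\<rho> (j - 1)..\<rho> j} (\<lambda>s. h (g s))"
    using continuous_on_compose2[OF assms(2) g(1)] by simp
  then show "\<exists>g. continuous_on {\<rho> (j - 1)..\<rho> j} g \<and> (\<forall>s\<in>{\<rho> (j - 1)<..<\<rho> j}. h (f s) = g s)"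
    using g(2) by auto
qed

lemma pw_cont_Pair:
  assumes "pw_cont J \<rho> f" "pw_cont J \<rho> g"
  shows "pw_cont J \<rho> (\<lambda>s. (f s, g s))"
  unfolding pw_cont_def
proof
  fix j assume "j \<in> {1..J}"
  then obtain f' g' where g: "continuous_on {\<rho> (j - 1)..\<rho> j} f'" "continuous_on {\<rho> (j - 1)..\<rho> j} g'"
      "\<And>s. s \<in> {\<rho> (j - 1)<..<\<rho> j} \<Longrightarrow> f s = f' s" "\<And>s. s \<in> {\<rho> (j - 1)<..<\<rho> j} \<Longrightarrow> g s = g' s"
    using assms unfolding pw_cont_def by metis
  then show "\<exists>h. continuous_on {\<rho> (j - 1)..\<rho> j} h \<and> (\<forall>s\<in>{\<rho> (j - 1)<..<\<rho> j}. (f s, g s) = h s)"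
    by (intro exI[of _ "\<lambda>s. (f' s, g' s)"]) (auto intro!: continuous_intros)
qed

lemma pw_cont_compose2:
  assumes "pw_cont J \<rho> f" "pw_cont J \<rho> g" "continuous_on UNIV (\<lambda>p. h (fst p) (snd p))"
  shows "pw_cont J \<rho> (\<lambda>s. h (f s) (g s))"
  using pw_cont_compose[OF pw_cont_Pair[OF assms(1,2)] assms(3)] by simp

lemma pw_cont_add:
  fixes f g :: "real \<Rightarrow> 'a::real_normed_vector"
  shows "pw_cont J \<rho> f \<Longrightarrow> pw_cont J \<rho> g \<Longrightarrow> pw_cont J \<rho> (\<lambda>s. f s + g s)"
  by (rule pw_cont_compose2[where h="(+)"]) (auto intro!: continuous_on_add continuous_on_fst continuous_on_snd)

lemma pw_cont_diff:
  fixes f g :: "real \<Rightarrow> 'a::real_normed_vector"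
  shows "pw_cont J \<rho> f \<Longrightarrow> pw_cont J \<rho> g \<Longrightarrow> pw_cont J \<rho> (\<lambda>s. f s - g s)"
  by (rule pw_cont_compose2[where h="(-)"]) (auto intro!: continuous_on_diff continuous_on_fst continuous_on_snd)

lemma pw_cont_scaleR:
  fixes g :: "real \<Rightarrow> 'a::real_normed_vector"
  shows "pw_cont J \<rho> f \<Longrightarrow> pw_cont J \<rho> g \<Longrightarrow> pw_cont J \<rho> (\<lambda>s. f s *\<^sub>R g s)"
  by (rule pw_cont_compose2[where h="(*\<^sub>R)"]) (auto intro!: continuous_on_scaleR continuous_on_fst continuous_on_snd)

lemma pw_cont_mult:
  fixes f g :: "real \<Rightarrow> real"
  shows "pw_cont J \<rho> f \<Longrightarrow> pw_cont J \<rho> g \<Longrightarrow> pw_cont J \<rho> (\<lambda>s. f s * g s)"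
  by (rule pw_cont_compose2[where h="(*)"]) (auto intro!: continuous_on_mult continuous_on_fst continuous_on_snd)

lemma pw_cont_inner:
  fixes f g :: "real \<Rightarrow> 'a::real_inner"
  shows "pw_cont J \<rho> f \<Longrightarrow> pw_cont J \<rho> g \<Longrightarrow> pw_cont J \<rho> (\<lambda>s. f s \<bullet> g s)"
  by (rule pw_cont_compose2[where h="(\<bullet>)"]) (auto intro!: continuous_on_inner continuous_on_fst continuous_on_snd)

lemma pw_cont_norm_power:
  fixes f :: "real \<Rightarrow> 'a::real_normed_vector"
  shows "pw_cont J \<rho> f \<Longrightarrow> pw_cont J \<rho> (\<lambda>s. (norm (f s))\<^sup>2)"
  by (rule pw_cont_compose) (auto intro!: continuous_on_power continuous_on_norm)

lemma pw_cont_const: "pw_cont J \<rho> (\<lambda>s. c)"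
  by (rule pw_cont_continuous) auto

lemmas pw_cont_intros = pw_cont_add pw_cont_diff pw_cont_scaleR pw_cont_mult pw_cont_inner
  pw_cont_norm_power pw_cont_const

lemma mesh_nodes_mono:
  assumes "mesh J \<rho>" "i \<le> j" "j \<le> J"
  shows "\<rho> i \<le> \<rho> j"
  using assms(2,3)
proof (induction j rule: dec_induct)
  case (step n)
  then have "\<rho> n < \<rho> (Suc n)" using assms(1) unfolding mesh_def by (metis atLeastAtMost_iff diff_Suc_1 le_add1 plus_1_eq_Suc)
  with step show ?case by simp
qed simp

lemma mesh_element:
  assumes "mesh J \<rho>" "j \<in> {1..J}"
  shows "\<rho> (j - 1) < \<rho> j" "{\<rho> (j - 1)..\<rho> j} \<subseteq> {0..1}"
  using assms mesh_nodes_mono[of J \<rho> 0 "j - 1"] mesh_nodes_mono[of J \<rho> j J] by (auto simp: mesh_def)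

lemma mesh_covers:
  assumes "mesh J \<rho>" "s \<in> {0..1}"
  obtains j where "j \<in> {1..J}" "s \<in> {\<rho> (j - 1)..\<rho> j}"
proof -
  have "J \<noteq> 0"
    using assms(1) by (metis mesh_def zero_neq_one)
  \<comment> \<open>The first node at or to the right of \<open>s\<close>, not counting the node \<open>0\<close>, which ends no element.\<close>
  define j where "j = (LEAST j. 1 \<le> j \<and> s \<le> \<rho> j)"
  have ex: "1 \<le> J \<and> s \<le> \<rho> J" using assms \<open>J \<noteq> 0\<close> by (auto simp: mesh_def)
  have j: "1 \<le> j" "s \<le> \<rho> j" "j \<le> J"
    using LeastI[of "\<lambda>j. 1 \<le> j \<and> s \<le> \<rho> j", OF ex] Least_le[of "\<lambda>j. 1 \<le> j \<and> s \<le> \<rho> j", OF ex]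
    by (auto simp: j_def)
  have "\<rho> (j - 1) \<le> s"
  proof (cases "j = 1")
    case True
    then show ?thesis using assms by (auto simp: mesh_def)
  next
    case False
    then have "\<not> (1 \<le> j - 1 \<and> s \<le> \<rho> (j - 1))"
      using j(1) not_less_Least[of "j - 1" "\<lambda>j. 1 \<le> j \<and> s \<le> \<rho> j"] unfolding j_def[symmetric] by auto
    then show ?thesis using False j(1) by auto
  qed
  then show ?thesis using that[of j] j by auto
qed

lemma mesh_off_nodes:
  assumes "mesh J \<rho>" "s \<in> {0..1} - \<rho> ` {0..J}"
  obtains j where "j \<in> {1..J}" "s \<in> {\<rho> (j - 1)<..<\<rho> j}"
proof -
  obtain j where j: "j \<in> {1..J}" "s \<in> {\<rho> (j - 1)..\<rho> j}"
    using mesh_covers assms by (metis DiffD1)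
  then have "s \<noteq> \<rho> (j - 1)" "s \<noteq> \<rho> j" using assms(2) by auto
  with that j show ?thesis by auto
qed

text \<open>
  The nodes form a null set, so identities involving derivatives are only needed inside the
  elements.
\<close>

lemma integral_cong_elements:
  assumes "mesh J \<rho>"
    and "\<And>j s. j \<in> {1..J} \<Longrightarrow> s \<in> {\<rho> (j - 1)<..<\<rho> j} \<Longrightarrow> f s = g s"
  shows "integral {0..1} f = integral {0..1} g"
proof (rule integral_spike[of "\<rho> ` {0..J}"])
  fix s assume "s \<in> {0..1} - \<rho> ` {0..J}"
  then show "g s = f s" using mesh_off_nodes[OF assms(1)] assms(2) by metis
qed (simp add: negligible_finite)

lemma pw_cont_integrable:
  fixes f :: "real \<Rightarrow> 'a::banach"
  assumes "mesh J \<rho>" "pw_cont J \<rho> f"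
  shows "f integrable_on {0..1}"
proof -
  have element: "f integrable_on {\<rho> (j - 1)..\<rho> j}" if "j \<in> {1..J}" for j
  proof -
    obtain g where g: "continuous_on {\<rho> (j - 1)..\<rho> j} g"
        "\<And>s. s \<in> {\<rho> (j - 1)<..<\<rho> j} \<Longrightarrow> f s = g s"
      using assms(2) \<open>j \<in> {1..J}\<close> unfolding pw_cont_def by metis
    then show ?thesis
      using integrable_spike_interior[of "\<rho> (j - 1)" "\<rho> j" f g] integrable_continuous_real by auto
  qed
  have "f integrable_on {0..\<rho> j}" if "j \<le> J" for j
    using that
  proof (induction j)
    case 0
    then show ?case using assms(1) integrable_on_refl[of f 0] by (simp add: mesh_def)
  next
    case (Suc j)
    have "\<rho> 0 \<le> \<rho> j" "\<rho> j \<le> \<rho> (Suc j)" "\<rho> 0 = 0"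
      using mesh_nodes_mono[OF assms(1), of 0 j] mesh_nodes_mono[OF assms(1), of j "Suc j"] Suc.prems assms(1)
      by (auto simp: mesh_def)
    then show ?case
      using Henstock_Kurzweil_Integration.integrable_combine[of 0 "\<rho> j" "\<rho> (Suc j)" f] Suc element[of "Suc j"] by auto
  qed
  from this[of J] show ?thesis using assms(1) by (simp add: mesh_def)
qed

text \<open>
  The continuous representative \<open>g\<close> on the closed element need not be known to be nonnegative at
  the end points, so the argument is carried out with \<open>\<bar>g\<bar>\<close>.
\<close>

lemma pw_cont_nonneg_integral_zero:
  fixes f :: "real \<Rightarrow> real"
  assumes mesh: "mesh J \<rho>" and f: "pw_cont J \<rho> f"
    and nonneg: "\<And>s. 0 \<le> f s" and zero: "integral {0..1} f = 0"
    and j: "j \<in> {1..J}" and s: "s \<in> {\<rho> (j - 1)<..<\<rho> j}"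
  shows "f s = 0"
proof -
  let ?I = "{\<rho> (j - 1)..\<rho> j}"
  obtain g where g: "continuous_on ?I g" "\<And>s. s \<in> {\<rho> (j - 1)<..<\<rho> j} \<Longrightarrow> f s = g s"
    using f j unfolding pw_cont_def by metis
  have int: "f integrable_on {0..1}" using pw_cont_integrable mesh f by blast
  have sub: "?I \<subseteq> {0..1}" using mesh_element[OF mesh j] by simp
  have intI: "f integrable_on ?I" using integrable_on_subinterval int sub by blast
  have "integral ?I f \<le> 0"
    using integral_subset_le[OF sub intI int] nonneg zero by simp
  moreover have "integral ?I f \<ge> 0" using integral_nonneg intI nonneg by blast
  moreover have "integral ?I f = integral ?I (\<lambda>s. \<bar>g s\<bar>)"
  proof (rule integral_spike[of "{\<rho> (j - 1), \<rho> j}"])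
    fix t assume "t \<in> ?I - {\<rho> (j - 1), \<rho> j}"
    then have "t \<in> {\<rho> (j - 1)<..<\<rho> j}" by auto
    then show "\<bar>g t\<bar> = f t" using g(2)[of t] nonneg[of t] by simp
  qed (simp add: negligible_finite)
  ultimately have "integral ?I (\<lambda>s. \<bar>g s\<bar>) = 0" by simp
  moreover have "continuous_on ?I (\<lambda>s. \<bar>g s\<bar>)" using g(1) by (intro continuous_intros)
  ultimately have "\<forall>t\<in>?I. \<bar>g t\<bar> = 0"
    using integral_eq_0_iff[of "\<rho> (j - 1)" "\<rho> j" "\<lambda>s. \<bar>g s\<bar>"] mesh_element(1)[OF mesh j] by simp
  then show ?thesis using g(2)[OF s] s by auto
qed

section \<open>The finite element space\<close>

lemma Vh_vec_affine:
  assumes "f \<in> Vh_vec J \<rho>" "j \<in> {1..J}"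
  obtains a b where "\<And>s. s \<in> {\<rho> (j - 1)..\<rho> j} \<Longrightarrow> f s = s *\<^sub>R a + b"
proof -
  have "\<forall>i. \<exists>a b. \<forall>s\<in>{\<rho> (j - 1)..\<rho> j}. f s $ i = a * s + b"
    using assms by (auto simp: Vh_vec_def Vh_def)
  then obtain a b where ab: "\<And>i s. s \<in> {\<rho> (j - 1)..\<rho> j} \<Longrightarrow> f s $ i = a i * s + b i"
    by metis
  show ?thesis
    by (rule that[of "vec_lambda a" "vec_lambda b"]) (simp add: vec_eq_iff ab mult.commute)
qed

lemma Vh_vec_drho:
  assumes "f \<in> Vh_vec J \<rho>" "j \<in> {1..J}"
  obtains a b where "\<And>s. s \<in> {\<rho> (j - 1)..\<rho> j} \<Longrightarrow> f s = s *\<^sub>R a + b"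
    "\<And>s. s \<in> {\<rho> (j - 1)<..<\<rho> j} \<Longrightarrow> (f has_vector_derivative a) (at s)"
    "\<And>s. s \<in> {\<rho> (j - 1)<..<\<rho> j} \<Longrightarrow> drho f s = a"
proof -
  obtain a b where ab: "\<And>s. s \<in> {\<rho> (j - 1)..\<rho> j} \<Longrightarrow> f s = s *\<^sub>R a + b"
    using Vh_vec_affine assms by metis
  have deriv: "(f has_vector_derivative a) (at s)" if s: "s \<in> {\<rho> (j - 1)<..<\<rho> j}" for s
  proof (rule has_vector_derivative_transform_within_open[where S = "{\<rho> (j - 1)<..<\<rho> j}"])
    show "((\<lambda>s. s *\<^sub>R a + b) has_vector_derivative a) (at s)"
      by (auto intro!: derivative_eq_intros)
  qed (use s ab in auto)
  then show ?thesis using that[OF ab deriv] by (simp add: drho_def vector_derivative_at)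
qed

lemma Vh_vec_has_drho:
  assumes "f \<in> Vh_vec J \<rho>" "j \<in> {1..J}" "s \<in> {\<rho> (j - 1)<..<\<rho> j}"
  shows "(f has_vector_derivative drho f s) (at s)"
  using Vh_vec_drho[OF assms(1,2)] assms(3) by metis

lemma drho_add:
  assumes "f \<in> Vh_vec J \<rho>" "g \<in> Vh_vec J \<rho>" "j \<in> {1..J}" "s \<in> {\<rho> (j - 1)<..<\<rho> j}"
  shows "drho (f + g) s = drho f s + drho g s"
  using has_vector_derivative_add[OF assms(1,2)[THEN Vh_vec_has_drho, OF assms(3,4)]]
  by (simp add: drho_def vector_derivative_at plus_fun_def)

lemma drho_scaleR:
  assumes "f \<in> Vh_vec J \<rho>" "j \<in> {1..J}" "s \<in> {\<rho> (j - 1)<..<\<rho> j}"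
  shows "drho (r *\<^sub>R f) s = r *\<^sub>R drho f s"
  using has_vector_derivative_scaleR[OF DERIV_const[of r] Vh_vec_has_drho[OF assms]]
  by (simp add: drho_def vector_derivative_at scaleR_fun_def)

lemma drho_zero [simp]: "drho 0 s = 0"
  by (simp add: drho_def zero_fun_def)

lemma subspace_Vh_vec: "subspace (Vh_vec J \<rho>)"
proof -
  have add: "(\<lambda>s. f s + g s) \<in> Vh J \<rho>" if "f \<in> Vh J \<rho>" "g \<in> Vh J \<rho>" for f g
  proof -
    have "\<exists>a b. \<forall>s\<in>{\<rho> (j - 1)..\<rho> j}. f s + g s = a * s + b" if j: "j \<in> {1..J}" for j
    proof -
      obtain a b a' b' where "\<forall>s\<in>{\<rho> (j - 1)..\<rho> j}. f s = a * s + b" "\<forall>s\<in>{\<rho> (j - 1)..\<rho> j}. g s = a' * s + b'"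
        using j \<open>f \<in> Vh J \<rho>\<close> \<open>g \<in> Vh J \<rho>\<close> unfolding Vh_def by blast
      then show ?thesis by (intro exI[of _ "a + a'"] exI[of _ "b + b'"]) (auto simp: algebra_simps)
    qed
    then show ?thesis using that by (auto simp: Vh_def intro!: continuous_intros)
  qed
  have scale: "(\<lambda>s. r * f s) \<in> Vh J \<rho>" if "f \<in> Vh J \<rho>" for f r
  proof -
    have "\<exists>a b. \<forall>s\<in>{\<rho> (j - 1)..\<rho> j}. r * f s = a * s + b" if j: "j \<in> {1..J}" for j
    proof -
      obtain a b where "\<forall>s\<in>{\<rho> (j - 1)..\<rho> j}. f s = a * s + b"
        using j \<open>f \<in> Vh J \<rho>\<close> unfolding Vh_def by blast
      then show ?thesis by (intro exI[of _ "r * a"] exI[of _ "r * b"]) (auto simp: algebra_simps)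
    qed
    then show ?thesis using that by (auto simp: Vh_def intro!: continuous_intros)
  qed
  have zero: "(\<lambda>s. 0) \<in> Vh J \<rho>" by (auto simp: Vh_def intro!: exI[of _ 0])
  show ?thesis by (auto simp: subspace_def Vh_vec_def add scale zero)
qed

lemma pw_cont_Vh_vec:
  assumes "f \<in> Vh_vec J \<rho>" shows "pw_cont J \<rho> f"
proof (rule pw_cont_continuous)
  have "continuous_on UNIV (\<lambda>s. f s $ i)" for i
    using assms by (simp add: Vh_vec_def Vh_def)
  then have "continuous_on UNIV (\<lambda>s. \<chi> i. f s $ i)" by (rule continuous_on_vec_lambda)
  then show "continuous_on UNIV f" by simp
qed

lemma pw_cont_drho:
  assumes "f \<in> Vh_vec J \<rho>" shows "pw_cont J \<rho> (drho f)"
  unfolding pw_cont_def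
proof
  fix j assume "j \<in> {1..J}"
  then obtain a where "\<And>s. s \<in> {\<rho> (j - 1)<..<\<rho> j} \<Longrightarrow> drho f s = a"
    using Vh_vec_drho assms by metis
  then show "\<exists>g. continuous_on {\<rho> (j - 1)..\<rho> j} g \<and> (\<forall>s\<in>{\<rho> (j - 1)<..<\<rho> j}. drho f s = g s)"
    by (intro exI[of _ "\<lambda>_. a"]) auto
qed

text \<open>
  Two zeros determine an affine function, and periodicity carries the conclusion from the unit
  interval to the line.  The two zeros may be chosen as interior points or as nodes; both
  versions are used, the first for functions whose weighted norm vanishes and the second to bound
  the dimension of the space.
\<close>

lemma Vh_vec_eq_zero:
  assumes mesh: "mesh J \<rho>" and f: "f \<in> Vh_vec J \<rho>"
    and zero: "\<And>j. j \<in> {1..J} \<Longrightarrow> \<exists>s\<in>{\<rho> (j - 1)..\<rho> j}. \<exists>t\<in>{\<rho> (j - 1)..\<rho> j}. s \<noteq> t \<and> f s = 0 \<and> f t = 0"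
  shows "f = 0"
proof
  have periodic: "f (s + 1) = f s" for s
    using f by (simp add: Vh_vec_def Vh_def vec_eq_iff)
  interpret periodic_fun_simple' f by standard (rule periodic)
  have unit: "f s = 0" if "s \<in> {0..1}" for s
  proof -
    obtain j where j: "j \<in> {1..J}" "s \<in> {\<rho> (j - 1)..\<rho> j}"
      using mesh_covers mesh \<open>s \<in> {0..1}\<close> by metis
    obtain a b where ab: "\<And>s. s \<in> {\<rho> (j - 1)..\<rho> j} \<Longrightarrow> f s = s *\<^sub>R a + b"
      using Vh_vec_affine f j(1) by metis
    obtain p q where pq: "p \<in> {\<rho> (j - 1)..\<rho> j}" "q \<in> {\<rho> (j - 1)..\<rho> j}" "p \<noteq> q" "f p = 0" "f q = 0"
      using zero[OF j(1)] by blast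
    have "p *\<^sub>R a + b = 0" "q *\<^sub>R a + b = 0" using pq ab by auto
    then have "p *\<^sub>R a = q *\<^sub>R a" by (metis add_right_cancel)
    then have "a = 0" using \<open>p \<noteq> q\<close> by simp
    then show ?thesis using ab j(2) \<open>p *\<^sub>R a + b = 0\<close> by simp
  qed
  fix s
  have "f (frac s + of_int \<lfloor>s\<rfloor>) = f (frac s)" by (rule plus_of_int)
  then show "f s = 0 s" using unit[of "frac s"] frac_lt_1[of s] by (simp add: frac_def)
qed

lemma Vh_vec_eq_zero_elements:
  assumes mesh: "mesh J \<rho>" and f: "f \<in> Vh_vec J \<rho>"
    and zero: "\<And>j s. j \<in> {1..J} \<Longrightarrow> s \<in> {\<rho> (j - 1)<..<\<rho> j} \<Longrightarrow> f s = 0"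
  shows "f = 0"
proof (rule Vh_vec_eq_zero[OF mesh f])
  fix j assume j: "j \<in> {1..J}"
  obtain p where p: "\<rho> (j - 1) < p" "p < \<rho> j" using dense mesh_element(1)[OF mesh j] by blast
  then obtain q where q: "p < q" "q < \<rho> j" using dense by blast
  then show "\<exists>s\<in>{\<rho> (j - 1)..\<rho> j}. \<exists>t\<in>{\<rho> (j - 1)..\<rho> j}. s \<noteq> t \<and> f s = 0 \<and> f t = 0"
    using zero[OF j] p by (intro bexI[of _ p] bexI[of _ q]) auto
qed

lemma Vh_vec_eq_zero_nodes:
  assumes mesh: "mesh J \<rho>" and f: "f \<in> Vh_vec J \<rho>"
    and zero: "\<And>j. j \<in> {1..J} \<Longrightarrow> f (\<rho> j) = 0"
  shows "f = 0"
proof (rule Vh_vec_eq_zero[OF mesh f])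
  have "f (0 + 1) = f 0"
    using f unfolding Vh_vec_def Vh_def vec_eq_iff mem_Collect_eq by blast
  moreover have "J \<ge> 1" using mesh by (cases J) (auto simp: mesh_def)
  ultimately have "f (\<rho> 0) = 0" using zero[of J] mesh by (simp add: mesh_def)
  then have all: "f (\<rho> j) = 0" if "j \<le> J" for j using zero[of j] that by (cases j) auto
  fix j assume j: "j \<in> {1..J}"
  then show "\<exists>s\<in>{\<rho> (j - 1)..\<rho> j}. \<exists>t\<in>{\<rho> (j - 1)..\<rho> j}. s \<noteq> t \<and> f s = 0 \<and> f t = 0"
    using all[of j] all[of "j - 1"] mesh_element(1)[OF mesh j]
    by (intro bexI[of _ "\<rho> j"] bexI[of _ "\<rho> (j - 1)"]) auto
qed

lemma finite_basis_Vh_vec_pairs: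
  assumes "mesh J \<rho>"
  obtains B :: "((real \<Rightarrow> real ^ 'n) \<times> (real \<Rightarrow> real ^ 'n)) set"
  where "finite B" "independent B" "span B = Vh_vec J \<rho> \<times> Vh_vec J \<rho>"
proof (rule finite_basis_if_separated[where K = "{1..J}"])
  let ?E = "\<lambda>(u :: (real \<Rightarrow> real ^ 'n) \<times> (real \<Rightarrow> real ^ 'n)) k.
    if k \<in> {1..J} then (fst u (\<rho> k), snd u (\<rho> k)) else 0"
  show "linear ?E"
    by (rule linearI) (auto simp: fun_eq_iff)
  show "subspace (Vh_vec J \<rho> \<times> Vh_vec J \<rho> :: ((real \<Rightarrow> real ^ 'n) \<times> (real \<Rightarrow> real ^ 'n)) set)"
    by (intro subspace_Times subspace_Vh_vec)
  fix u :: "(real \<Rightarrow> real ^ 'n) \<times> (real \<Rightarrow> real ^ 'n)"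
  assume u: "u \<in> Vh_vec J \<rho> \<times> Vh_vec J \<rho>" "?E u = 0"
  have "fst u (\<rho> j) = 0 \<and> snd u (\<rho> j) = 0" if "j \<in> {1..J}" for j
    using fun_cong[OF u(2), of j] that by (simp add: zero_prod_def)
  then have "fst u = 0" "snd u = 0"
    using u(1) by (auto intro: Vh_vec_eq_zero_nodes[OF assms])
  then show "u = 0" by (simp add: prod_eq_iff)
qed auto

section \<open>The scheme as a single bilinear form\<close>

lemma F2_mult_vec:
  "F2 a b c *v y = 2 *\<^sub>R ((a \<bullet> y) *\<^sub>R c - (c \<bullet> y) *\<^sub>R a)
     + (2 * (a \<bullet> b)) *\<^sub>R ((b \<bullet> y) *\<^sub>R a - (a \<bullet> y) *\<^sub>R b)"
  by (simp add: F2_def matrix_vector_mult_add_rdistrib matrix_vector_mult_diff_rdistrib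
      scaleR_matrix_vector_assoc[symmetric] outer_mult_vec)

text \<open>
  This is why the term with \<open>F\<^sub>2\<close> does not contribute to the energy balance.
\<close>

lemma F2_antisymmetric: "(F2 a b c *v y) \<bullet> y = 0"
  by (simp add: F2_mult_vec inner_add_left inner_diff_left algebra_simps)

text \<open>
  Here \<open>u = (X, Y)\<close> is the pair of unknowns and \<open>v = (\<phi>, \<eta>)\<close> the pair of test functions.  The
  two equations of the scheme are added up, all terms that contain an unknown are collected in
  \<open>scheme_integrand\<close>, and those with \<open>x\<^sup>m\<close> in \<open>load_integrand\<close>.
\<close>

definition scheme_integrand :: "real \<Rightarrow> (real \<Rightarrow> real ^ 'n) \<Rightarrow> (real \<Rightarrow> real ^ 'n) \<Rightarrow>
    (real \<Rightarrow> real ^ 'n) \<times> (real \<Rightarrow> real ^ 'n) \<Rightarrow> (real \<Rightarrow> real ^ 'n) \<times> (real \<Rightarrow> real ^ 'n) \<Rightarrow> real \<Rightarrow> real" where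
  "scheme_integrand \<Delta>t xh zh u v s =
     (norm (drho xh s))\<^sup>2 * (1 / \<Delta>t * (fst u s \<bullet> fst v s))
     - drho (snd u) s \<bullet> drho (fst v) s
     - 2 * ((drho (snd u) s \<bullet> drho xh s) * (zh s \<bullet> fst v s))
     - (norm (drho xh s))\<^sup>2 * ((zh s \<bullet> snd u s) * (zh s \<bullet> fst v s))
     - (F2 (drho xh s) (zh s) (drho zh s) *v snd u s) \<bullet> fst v s
     + (norm (drho xh s))\<^sup>2 * (snd u s \<bullet> snd v s)
     + 1/2 * (drho (fst u) s \<bullet> drho (snd v) s)"

definition load_integrand :: "real \<Rightarrow> (real \<Rightarrow> real ^ 'n) \<Rightarrow> (real \<Rightarrow> real ^ 'n) \<Rightarrow>
    (real \<Rightarrow> real ^ 'n) \<times> (real \<Rightarrow> real ^ 'n) \<Rightarrow> real \<Rightarrow> real" where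
  "load_integrand \<Delta>t xm xh v s =
     (norm (drho xh s))\<^sup>2 * (1 / \<Delta>t * (xm s \<bullet> fst v s)) - 1/2 * (drho xm s \<bullet> drho (snd v) s)"

definition scheme_form :: "real \<Rightarrow> (real \<Rightarrow> real ^ 'n) \<Rightarrow> (real \<Rightarrow> real ^ 'n) \<Rightarrow>
    (real \<Rightarrow> real ^ 'n) \<times> (real \<Rightarrow> real ^ 'n) \<Rightarrow> (real \<Rightarrow> real ^ 'n) \<times> (real \<Rightarrow> real ^ 'n) \<Rightarrow> real" where
  "scheme_form \<Delta>t xh zh u v = integral {0..1} (scheme_integrand \<Delta>t xh zh u v)"

definition scheme_load :: "real \<Rightarrow> (real \<Rightarrow> real ^ 'n) \<Rightarrow> (real \<Rightarrow> real ^ 'n) \<Rightarrow>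
    (real \<Rightarrow> real ^ 'n) \<times> (real \<Rightarrow> real ^ 'n) \<Rightarrow> real" where
  "scheme_load \<Delta>t xm xh v = integral {0..1} (load_integrand \<Delta>t xm xh v)"

lemma H1_seminorm_squared:
  assumes "mesh J \<rho>" "u \<in> Vh_vec J \<rho>"
  shows "(H1_seminorm u)\<^sup>2 = integral {0..1} (\<lambda>s. (norm (drho u s))\<^sup>2)"
proof -
  have "(\<lambda>s. (norm (drho u s))\<^sup>2) integrable_on {0..1}"
    by (intro pw_cont_integrable[OF assms(1)] pw_cont_intros pw_cont_drho assms(2))
  then show ?thesis by (simp add: H1_seminorm_def integral_nonneg)
qed

context
  fixes J :: nat and \<rho> :: "nat \<Rightarrow> real" and \<Delta>t :: real
    and xh zh :: "real \<Rightarrow> real ^ 'n"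
  assumes mesh: "mesh J \<rho>" and xh: "xh \<in> Vh_vec J \<rho>" and zh: "zh \<in> Vh_vec J \<rho>"
begin

lemma pw_cont_F2_mult:
  assumes "Y \<in> Vh_vec J \<rho>"
  shows "pw_cont J \<rho> (\<lambda>s. F2 (drho xh s) (zh s) (drho zh s) *v Y s)"
  unfolding F2_mult_vec by (intro pw_cont_intros pw_cont_drho pw_cont_Vh_vec assms xh zh)

lemma pw_cont_scheme_integrand:
  assumes "u \<in> Vh_vec J \<rho> \<times> Vh_vec J \<rho>" "v \<in> Vh_vec J \<rho> \<times> Vh_vec J \<rho>"
  shows "pw_cont J \<rho> (scheme_integrand \<Delta>t xh zh u v)"
proof -
  have "fst u \<in> Vh_vec J \<rho>" "snd u \<in> Vh_vec J \<rho>" "fst v \<in> Vh_vec J \<rho>" "snd v \<in> Vh_vec J \<rho>"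
    using assms by auto
  then show ?thesis
    unfolding scheme_integrand_def
    by (intro pw_cont_intros pw_cont_F2_mult pw_cont_drho pw_cont_Vh_vec xh zh)
qed

lemma pw_cont_load_integrand:
  assumes "xm \<in> Vh_vec J \<rho>" "v \<in> Vh_vec J \<rho> \<times> Vh_vec J \<rho>"
  shows "pw_cont J \<rho> (load_integrand \<Delta>t xm xh v)"
proof -
  have "fst v \<in> Vh_vec J \<rho>" "snd v \<in> Vh_vec J \<rho>"
    using assms by auto
  then show ?thesis
    unfolding load_integrand_def
    by (intro pw_cont_intros pw_cont_drho pw_cont_Vh_vec xh assms(1))
qed

lemma scheme_form_add_left:
  assumes "u \<in> Vh_vec J \<rho> \<times> Vh_vec J \<rho>" "u' \<in> Vh_vec J \<rho> \<times> Vh_vec J \<rho>" "v \<in> Vh_vec J \<rho> \<times> Vh_vec J \<rho>"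
  shows "scheme_form \<Delta>t xh zh (u + u') v = scheme_form \<Delta>t xh zh u v + scheme_form \<Delta>t xh zh u' v"
proof -
  have "scheme_form \<Delta>t xh zh (u + u') v
      = integral {0..1} (\<lambda>s. scheme_integrand \<Delta>t xh zh u v s + scheme_integrand \<Delta>t xh zh u' v s)"
    unfolding scheme_form_def
  proof (rule integral_cong_elements[OF mesh])
    fix j s assume j: "j \<in> {1..J}" "s \<in> {\<rho> (j - 1)<..<\<rho> j}"
    have "drho (fst u + fst u') s = drho (fst u) s + drho (fst u') s"
      "drho (snd u + snd u') s = drho (snd u) s + drho (snd u') s"
      using assms drho_add[OF _ _ j] by auto
    then show "scheme_integrand \<Delta>t xh zh (u + u') v s
        = scheme_integrand \<Delta>t xh zh u v s + scheme_integrand \<Delta>t xh zh u' v s"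
      by (simp add: scheme_integrand_def inner_add_left inner_add_right matrix_vector_right_distrib algebra_simps)
  qed
  also have "\<dots> = scheme_form \<Delta>t xh zh u v + scheme_form \<Delta>t xh zh u' v"
    unfolding scheme_form_def
    by (intro integral_add pw_cont_integrable[OF mesh] pw_cont_scheme_integrand assms)
  finally show ?thesis .
qed

lemma scheme_form_scale_left:
  assumes "u \<in> Vh_vec J \<rho> \<times> Vh_vec J \<rho>" "v \<in> Vh_vec J \<rho> \<times> Vh_vec J \<rho>"
  shows "scheme_form \<Delta>t xh zh (r *\<^sub>R u) v = r * scheme_form \<Delta>t xh zh u v"
proof -
  have "scheme_form \<Delta>t xh zh (r *\<^sub>R u) v = integral {0..1} (\<lambda>s. r * scheme_integrand \<Delta>t xh zh u v s)"
    unfolding scheme_form_def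
  proof (rule integral_cong_elements[OF mesh])
    fix j s assume j: "j \<in> {1..J}" "s \<in> {\<rho> (j - 1)<..<\<rho> j}"
    have "drho (r *\<^sub>R fst u) s = r *\<^sub>R drho (fst u) s" "drho (r *\<^sub>R snd u) s = r *\<^sub>R drho (snd u) s"
      using assms drho_scaleR[OF _ j] by auto
    then show "scheme_integrand \<Delta>t xh zh (r *\<^sub>R u) v s = r * scheme_integrand \<Delta>t xh zh u v s"
      by (simp add: scheme_integrand_def matrix_vector_mult_scaleR algebra_simps)
  qed
  then show ?thesis by (simp add: scheme_form_def)
qed

lemma scheme_form_add_right:
  assumes "u \<in> Vh_vec J \<rho> \<times> Vh_vec J \<rho>" "v \<in> Vh_vec J \<rho> \<times> Vh_vec J \<rho>" "v' \<in> Vh_vec J \<rho> \<times> Vh_vec J \<rho>"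
  shows "scheme_form \<Delta>t xh zh u (v + v') = scheme_form \<Delta>t xh zh u v + scheme_form \<Delta>t xh zh u v'"
proof -
  have "scheme_form \<Delta>t xh zh u (v + v')
      = integral {0..1} (\<lambda>s. scheme_integrand \<Delta>t xh zh u v s + scheme_integrand \<Delta>t xh zh u v' s)"
    unfolding scheme_form_def
  proof (rule integral_cong_elements[OF mesh])
    fix j s assume j: "j \<in> {1..J}" "s \<in> {\<rho> (j - 1)<..<\<rho> j}"
    have "drho (fst v + fst v') s = drho (fst v) s + drho (fst v') s"
      "drho (snd v + snd v') s = drho (snd v) s + drho (snd v') s"
      using assms drho_add[OF _ _ j] by auto
    then show "scheme_integrand \<Delta>t xh zh u (v + v') s
        = scheme_integrand \<Delta>t xh zh u v s + scheme_integrand \<Delta>t xh zh u v' s"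
      by (simp add: scheme_integrand_def inner_add_right algebra_simps)
  qed
  also have "\<dots> = scheme_form \<Delta>t xh zh u v + scheme_form \<Delta>t xh zh u v'"
    unfolding scheme_form_def
    by (intro integral_add pw_cont_integrable[OF mesh] pw_cont_scheme_integrand assms)
  finally show ?thesis .
qed

lemma scheme_form_scale_right:
  assumes "u \<in> Vh_vec J \<rho> \<times> Vh_vec J \<rho>" "v \<in> Vh_vec J \<rho> \<times> Vh_vec J \<rho>"
  shows "scheme_form \<Delta>t xh zh u (r *\<^sub>R v) = r * scheme_form \<Delta>t xh zh u v"
proof -
  have "scheme_form \<Delta>t xh zh u (r *\<^sub>R v) = integral {0..1} (\<lambda>s. r * scheme_integrand \<Delta>t xh zh u v s)"
    unfolding scheme_form_def
  proof (rule integral_cong_elements[OF mesh])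
    fix j s assume j: "j \<in> {1..J}" "s \<in> {\<rho> (j - 1)<..<\<rho> j}"
    have "drho (r *\<^sub>R fst v) s = r *\<^sub>R drho (fst v) s" "drho (r *\<^sub>R snd v) s = r *\<^sub>R drho (snd v) s"
      using assms drho_scaleR[OF _ j] by auto
    then show "scheme_integrand \<Delta>t xh zh u (r *\<^sub>R v) s = r * scheme_integrand \<Delta>t xh zh u v s"
      by (simp add: scheme_integrand_def algebra_simps)
  qed
  then show ?thesis by (simp add: scheme_form_def)
qed

lemma scheme_load_add:
  assumes "xm \<in> Vh_vec J \<rho>" "v \<in> Vh_vec J \<rho> \<times> Vh_vec J \<rho>" "v' \<in> Vh_vec J \<rho> \<times> Vh_vec J \<rho>"
  shows "scheme_load \<Delta>t xm xh (v + v') = scheme_load \<Delta>t xm xh v + scheme_load \<Delta>t xm xh v'"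
proof -
  have "scheme_load \<Delta>t xm xh (v + v')
      = integral {0..1} (\<lambda>s. load_integrand \<Delta>t xm xh v s + load_integrand \<Delta>t xm xh v' s)"
    unfolding scheme_load_def
  proof (rule integral_cong_elements[OF mesh])
    fix j s assume j: "j \<in> {1..J}" "s \<in> {\<rho> (j - 1)<..<\<rho> j}"
    have "drho (snd v + snd v') s = drho (snd v) s + drho (snd v') s"
      using assms drho_add[OF _ _ j] by auto
    then show "load_integrand \<Delta>t xm xh (v + v') s
        = load_integrand \<Delta>t xm xh v s + load_integrand \<Delta>t xm xh v' s"
      by (simp add: load_integrand_def inner_add_right algebra_simps)
  qed
  also have "\<dots> = scheme_load \<Delta>t xm xh v + scheme_load \<Delta>t xm xh v'"
    unfolding scheme_load_def
    by (intro integral_add pw_cont_integrable[OF mesh] pw_cont_load_integrand assms)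
  finally show ?thesis .
qed

lemma scheme_load_scale:
  assumes "v \<in> Vh_vec J \<rho> \<times> Vh_vec J \<rho>"
  shows "scheme_load \<Delta>t xm xh (r *\<^sub>R v) = r * scheme_load \<Delta>t xm xh v"
proof -
  have "scheme_load \<Delta>t xm xh (r *\<^sub>R v) = integral {0..1} (\<lambda>s. r * load_integrand \<Delta>t xm xh v s)"
    unfolding scheme_load_def
  proof (rule integral_cong_elements[OF mesh])
    fix j s assume j: "j \<in> {1..J}" "s \<in> {\<rho> (j - 1)<..<\<rho> j}"
    have "drho (r *\<^sub>R snd v) s = r *\<^sub>R drho (snd v) s"
      using assms drho_scaleR[OF _ j] by auto
    then show "load_integrand \<Delta>t xm xh (r *\<^sub>R v) s = r * load_integrand \<Delta>t xm xh v s"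
      by (simp add: load_integrand_def algebra_simps)
  qed
  then show ?thesis by (simp add: scheme_load_def)
qed

text \<open>
  Since \<open>\<phi>\<close> and \<open>\<eta>\<close> vary independently and may be \<open>0\<close>, the sum of the two residuals vanishes for
  all pairs exactly when each equation holds on its own.
\<close>

lemma scheme_solution_iff_weak_form:
  assumes xm: "xm \<in> Vh_vec J \<rho>"
  shows "scheme_solution J \<rho> \<Delta>t xm xh zh X Y \<longleftrightarrow>
     (X, Y) \<in> Vh_vec J \<rho> \<times> Vh_vec J \<rho> \<and>
     (\<forall>v\<in>Vh_vec J \<rho> \<times> Vh_vec J \<rho>. scheme_form \<Delta>t xh zh (X, Y) v = scheme_load \<Delta>t xm xh v)"
proof (cases "X \<in> Vh_vec J \<rho> \<and> Y \<in> Vh_vec J \<rho>")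
  case False
  then show ?thesis by (auto simp: scheme_solution_def)
next
  case True
  then have X: "X \<in> Vh_vec J \<rho>" and Y: "Y \<in> Vh_vec J \<rho>" by auto
  define P where "P \<phi> =
      L2_inner (\<lambda>s. (1 / \<Delta>t) *\<^sub>R (X s - xm s)) (\<lambda>s. (norm (drho xh s))\<^sup>2 *\<^sub>R \<phi> s)
      - L2_inner (drho Y) (drho \<phi>)
      - (2 * L2_inner (\<lambda>s. (drho Y s \<bullet> drho xh s) *\<^sub>R zh s) \<phi>
        + L2_inner (\<lambda>s. (zh s \<bullet> Y s) *\<^sub>R zh s) (\<lambda>s. (norm (drho xh s))\<^sup>2 *\<^sub>R \<phi> s)
        + L2_inner (\<lambda>s. F2 (drho xh s) (zh s) (drho zh s) *v Y s) \<phi>)" for \<phi>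
  define Q where "Q \<eta> =
      L2_inner Y (\<lambda>s. (norm (drho xh s))\<^sup>2 *\<^sub>R \<eta> s) + 1/2 * L2_inner (drho X) (drho \<eta>)
      - - (1/2) * L2_inner (drho xm) (drho \<eta>)" for \<eta>
  have L2: "((\<lambda>s. f s \<bullet> g s) has_integral L2_inner f g) {0..1}"
    if "pw_cont J \<rho> f" "pw_cont J \<rho> g" for f g :: "real \<Rightarrow> real ^ 'n"
    using pw_cont_integrable[OF mesh pw_cont_inner[OF that]] by (simp add: L2_inner_def has_integral_integral)
  \<comment> \<open>\<open>P \<phi> = 0\<close> and \<open>Q \<eta> = 0\<close> are the two equations of the scheme.\<close>
  have residual: "scheme_form \<Delta>t xh zh (X, Y) (\<phi>, \<eta>) - scheme_load \<Delta>t xm xh (\<phi>, \<eta>) = P \<phi> + Q \<eta>"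
    if \<phi>: "\<phi> \<in> Vh_vec J \<rho>" and \<eta>: "\<eta> \<in> Vh_vec J \<rho>" for \<phi> \<eta>
  proof -
    let ?f = "\<lambda>s. ((1 / \<Delta>t) *\<^sub>R (X s - xm s)) \<bullet> ((norm (drho xh s))\<^sup>2 *\<^sub>R \<phi> s)
      - drho Y s \<bullet> drho \<phi> s
      - (2 * (((drho Y s \<bullet> drho xh s) *\<^sub>R zh s) \<bullet> \<phi> s)
        + ((zh s \<bullet> Y s) *\<^sub>R zh s) \<bullet> ((norm (drho xh s))\<^sup>2 *\<^sub>R \<phi> s)
        + (F2 (drho xh s) (zh s) (drho zh s) *v Y s) \<bullet> \<phi> s)
      + (Y s \<bullet> ((norm (drho xh s))\<^sup>2 *\<^sub>R \<eta> s) + 1/2 * (drho X s \<bullet> drho \<eta> s)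
      - - (1/2) * (drho xm s \<bullet> drho \<eta> s))"
    have "(?f has_integral (P \<phi> + Q \<eta>)) {0..1}"
      unfolding P_def Q_def
      by (intro has_integral_add has_integral_diff has_integral_mult_right L2 pw_cont_intros
          pw_cont_F2_mult pw_cont_drho pw_cont_Vh_vec X Y xm xh zh \<phi> \<eta>)
    moreover have "?f = (\<lambda>s. scheme_integrand \<Delta>t xh zh (X, Y) (\<phi>, \<eta>) s - load_integrand \<Delta>t xm xh (\<phi>, \<eta>) s)"
      by (rule ext) (simp add: scheme_integrand_def load_integrand_def inner_diff_left diff_divide_distrib algebra_simps)
    moreover have "integral {0..1} (\<lambda>s. scheme_integrand \<Delta>t xh zh (X, Y) (\<phi>, \<eta>) s - load_integrand \<Delta>t xm xh (\<phi>, \<eta>) s)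
        = scheme_form \<Delta>t xh zh (X, Y) (\<phi>, \<eta>) - scheme_load \<Delta>t xm xh (\<phi>, \<eta>)"
      unfolding scheme_form_def scheme_load_def using X Y xm \<phi> \<eta>
      by (intro integral_diff pw_cont_integrable[OF mesh] pw_cont_scheme_integrand pw_cont_load_integrand) auto
    ultimately show ?thesis by (metis integral_unique)
  qed
  have zero: "P 0 = 0" "Q 0 = 0" "(0 :: real \<Rightarrow> real ^ 'n) \<in> Vh_vec J \<rho>"
    using subspace_0[OF subspace_Vh_vec] by (simp_all add: P_def Q_def L2_inner_def)
  have "scheme_solution J \<rho> \<Delta>t xm xh zh X Y \<longleftrightarrow> (\<forall>\<phi>\<in>Vh_vec J \<rho>. P \<phi> = 0) \<and> (\<forall>\<eta>\<in>Vh_vec J \<rho>. Q \<eta> = 0)"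
    using X Y by (simp add: scheme_solution_def P_def Q_def eq_neg_iff_add_eq_0)
  also have "\<dots> \<longleftrightarrow> (\<forall>\<phi>\<in>Vh_vec J \<rho>. \<forall>\<eta>\<in>Vh_vec J \<rho>. P \<phi> + Q \<eta> = 0)"
    using zero by (metis add_0 add_0_right)
  also have "\<dots> \<longleftrightarrow> (\<forall>v\<in>Vh_vec J \<rho> \<times> Vh_vec J \<rho>. scheme_form \<Delta>t xh zh (X, Y) v = scheme_load \<Delta>t xm xh v)"
    using residual by fastforce
  finally show ?thesis using X Y by simp
qed

section \<open>Energy identity and unique solvability\<close>

lemma energy_identity:
  assumes dt: "\<Delta>t > 0" and xm: "xm \<in> Vh_vec J \<rho>"
    and sol: "scheme_solution J \<rho> \<Delta>t xm xh zh X Y"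
  shows "1/2 * (H1_seminorm X)\<^sup>2
         + \<Delta>t * L2_inner (\<lambda>s. (norm (drho Y s + (zh s \<bullet> Y s) *\<^sub>R drho xh s))\<^sup>2) (\<lambda>s. 1)
       = 1/2 * (H1_seminorm xm)\<^sup>2"
proof -
  have X: "X \<in> Vh_vec J \<rho>" and Y: "Y \<in> Vh_vec J \<rho>"
    and weak: "\<And>v. v \<in> Vh_vec J \<rho> \<times> Vh_vec J \<rho> \<Longrightarrow> scheme_form \<Delta>t xh zh (X, Y) v = scheme_load \<Delta>t xm xh v"
    using sol unfolding scheme_solution_iff_weak_form[OF xm] by auto
  \<comment> \<open>The factor \<open>- \<Delta>t\<close> makes the difference quotient in the first equation cancel against the
    weighted term of the second equation tested with \<open>X - x\<^sup>m\<close>.\<close>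
  define v where "v = ((- \<Delta>t) *\<^sub>R Y, X + (- 1) *\<^sub>R xm)"
  have v: "v \<in> Vh_vec J \<rho> \<times> Vh_vec J \<rho>"
    unfolding v_def by (intro SigmaI subspace_add subspace_scale subspace_Vh_vec X Y xm)
  let ?D = "\<lambda>s. (norm (drho Y s + (zh s \<bullet> Y s) *\<^sub>R drho xh s))\<^sup>2"
  let ?e = "\<lambda>s. 1/2 * (norm (drho X s))\<^sup>2 + \<Delta>t * ?D s - 1/2 * (norm (drho xm s))\<^sup>2"
  have D: "pw_cont J \<rho> ?D"
    by (intro pw_cont_intros pw_cont_drho pw_cont_Vh_vec Y xh zh)
  have "0 = scheme_form \<Delta>t xh zh (X, Y) v - scheme_load \<Delta>t xm xh v" using weak[OF v] by simp
  also have "\<dots> = integral {0..1} (\<lambda>s. scheme_integrand \<Delta>t xh zh (X, Y) v s - load_integrand \<Delta>t xm xh v s)"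
    unfolding scheme_form_def scheme_load_def using X Y
    by (intro integral_diff[symmetric] pw_cont_integrable[OF mesh] pw_cont_scheme_integrand pw_cont_load_integrand v xm) auto
  also have "\<dots> = integral {0..1} ?e"
  proof (rule integral_cong_elements[OF mesh])
    fix j s assume j: "j \<in> {1..J}" "s \<in> {\<rho> (j - 1)<..<\<rho> j}"
    have d1: "drho (X + (- 1) *\<^sub>R xm) s = drho X s - drho xm s"
      using drho_add[OF X subspace_scale[OF subspace_Vh_vec xm] j, of "-1"] drho_scaleR[OF xm j, of "-1"] by simp
    have d2: "drho ((- \<Delta>t) *\<^sub>R Y) s = (- \<Delta>t) *\<^sub>R drho Y s"
      using drho_scaleR[OF Y j] .
    show "scheme_integrand \<Delta>t xh zh (X, Y) v s - load_integrand \<Delta>t xm xh v s = ?e s"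
      using dt unfolding scheme_integrand_def load_integrand_def v_def fst_conv snd_conv d1 d2
      by (simp add: trans[OF inner_commute F2_antisymmetric] power2_norm_eq_inner inner_add_left inner_add_right
          inner_diff_left inner_diff_right inner_commute algebra_simps)
  qed
  also have "\<dots> = 1/2 * integral {0..1} (\<lambda>s. (norm (drho X s))\<^sup>2) + \<Delta>t * integral {0..1} ?D
      - 1/2 * integral {0..1} (\<lambda>s. (norm (drho xm s))\<^sup>2)"
    by (intro integral_unique has_integral_add has_integral_diff has_integral_mult_right
        integrable_integral pw_cont_integrable[OF mesh] D pw_cont_norm_power pw_cont_drho X xm)
  finally show ?thesis
    using H1_seminorm_squared[OF mesh X] H1_seminorm_squared[OF mesh xm] by (simp add: L2_inner_def)
qed

text \<open>
  A null vector of the form solves the scheme with \<open>x\<^sup>m = 0\<close>.  The energy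
  identity then gives \<open>X\<^sub>\<rho> = 0\<close>; after that \<open>Y\<close> and \<open>X\<close>, in this order, are annihilated by testing with
  the functions themselves, where the weight \<open>|x\<^sub>\<rho>|\<^sup>2\<close> is positive inside every element.
\<close>

lemma scheme_form_nondegenerate:
  assumes dt: "\<Delta>t > 0"
    and nonzero: "\<forall>j\<in>{1..J}. \<forall>s\<in>{\<rho> (j - 1)<..<\<rho> j}. norm (drho xh s) > 0"
    and u: "u \<in> Vh_vec J \<rho> \<times> Vh_vec J \<rho>"
    and null: "\<And>v. v \<in> Vh_vec J \<rho> \<times> Vh_vec J \<rho> \<Longrightarrow> scheme_form \<Delta>t xh zh u v = 0"
  shows "u = 0"
proof -
  obtain X Y where XY: "u = (X, Y)" by force
  have X: "X \<in> Vh_vec J \<rho>" and Y: "Y \<in> Vh_vec J \<rho>" using u XY by auto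
  have V0: "(0 :: real \<Rightarrow> real ^ 'n) \<in> Vh_vec J \<rho>" using subspace_0[OF subspace_Vh_vec] .
  have "load_integrand \<Delta>t 0 xh v = (\<lambda>_. 0)" for v
    by (simp add: fun_eq_iff load_integrand_def)
  then have "scheme_solution J \<rho> \<Delta>t 0 xh zh X Y"
    using null X Y unfolding scheme_solution_iff_weak_form[OF V0] XY scheme_load_def by simp
  from energy_identity[OF dt V0 this]
  have energy: "1/2 * integral {0..1} (\<lambda>s. (norm (drho X s))\<^sup>2)
      + \<Delta>t * integral {0..1} (\<lambda>s. (norm (drho Y s + (zh s \<bullet> Y s) *\<^sub>R drho xh s))\<^sup>2) = 0"
    using H1_seminorm_squared[OF mesh X] H1_seminorm_squared[OF mesh V0] by (simp add: L2_inner_def)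
  have pw: "pw_cont J \<rho> (\<lambda>s. (norm (drho X s))\<^sup>2)"
    by (intro pw_cont_intros pw_cont_drho X)
  have "pw_cont J \<rho> (\<lambda>s. (norm (drho Y s + (zh s \<bullet> Y s) *\<^sub>R drho xh s))\<^sup>2)"
    by (intro pw_cont_intros pw_cont_drho pw_cont_Vh_vec Y xh zh)
  then have "0 \<le> \<Delta>t * integral {0..1} (\<lambda>s. (norm (drho Y s + (zh s \<bullet> Y s) *\<^sub>R drho xh s))\<^sup>2)"
    using dt integral_nonneg[OF pw_cont_integrable[OF mesh]] by simp
  moreover have "0 \<le> integral {0..1} (\<lambda>s. (norm (drho X s))\<^sup>2)"
    using integral_nonneg[OF pw_cont_integrable[OF mesh pw]] by simp
  ultimately have "integral {0..1} (\<lambda>s. (norm (drho X s))\<^sup>2) = 0"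
    using energy by linarith
  then have dX: "drho X s = 0" if "j \<in> {1..J}" "s \<in> {\<rho> (j - 1)<..<\<rho> j}" for j s
    using pw_cont_nonneg_integral_zero[OF mesh pw _ _ that] by simp
  have weighted_zero: "f = 0"
    if f: "f \<in> Vh_vec J \<rho>" and int: "integral {0..1} (\<lambda>s. (norm (drho xh s))\<^sup>2 * (norm (f s))\<^sup>2) = 0" for f
  proof (rule Vh_vec_eq_zero_elements[OF mesh f])
    fix j s assume j: "j \<in> {1..J}" "s \<in> {\<rho> (j - 1)<..<\<rho> j}"
    have "pw_cont J \<rho> (\<lambda>s. (norm (drho xh s))\<^sup>2 * (norm (f s))\<^sup>2)"
      by (intro pw_cont_intros pw_cont_drho pw_cont_Vh_vec f xh)
    from pw_cont_nonneg_integral_zero[OF mesh this _ int j]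
    have "(norm (drho xh s))\<^sup>2 * (norm (f s))\<^sup>2 = 0" by simp
    then show "f s = 0" using nonzero j by auto
  qed
  have "integral {0..1} (\<lambda>s. (norm (drho xh s))\<^sup>2 * (norm (Y s))\<^sup>2) = scheme_form \<Delta>t xh zh u (0, Y)"
    unfolding scheme_form_def
    by (rule integral_cong_elements[OF mesh]) (simp add: XY scheme_integrand_def dX power2_norm_eq_inner)
  then have "Y = 0" using weighted_zero[OF Y] null[of "(0, Y)"] V0 Y by simp
  have "scheme_form \<Delta>t xh zh u (X, 0) = integral {0..1} (\<lambda>s. 1 / \<Delta>t * ((norm (drho xh s))\<^sup>2 * (norm (X s))\<^sup>2))"
    unfolding scheme_form_def
    by (rule integral_cong_elements[OF mesh])
       (simp add: XY \<open>Y = 0\<close> scheme_integrand_def power2_norm_eq_inner)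
  also have "\<dots> = 1 / \<Delta>t * integral {0..1} (\<lambda>s. (norm (drho xh s))\<^sup>2 * (norm (X s))\<^sup>2)"
    by (rule integral_mult_right)
  finally have "X = 0" using weighted_zero[OF X] null[of "(X, 0)"] V0 X dt by simp
  then show ?thesis using XY \<open>Y = 0\<close> by (simp add: zero_prod_def)
qed

lemma weak_form_uniquely_solvable:
  assumes dt: "\<Delta>t > 0" and xm: "xm \<in> Vh_vec J \<rho>"
    and nonzero: "\<forall>j\<in>{1..J}. \<forall>s\<in>{\<rho> (j - 1)<..<\<rho> j}. norm (drho xh s) > 0"
  shows "\<exists>!u. u \<in> Vh_vec J \<rho> \<times> Vh_vec J \<rho> \<and>
    (\<forall>v\<in>Vh_vec J \<rho> \<times> Vh_vec J \<rho>. scheme_form \<Delta>t xh zh u v = scheme_load \<Delta>t xm xh v)"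
proof -
  let ?W = "Vh_vec J \<rho> \<times> Vh_vec J \<rho> :: ((real \<Rightarrow> real ^ 'n) \<times> (real \<Rightarrow> real ^ 'n)) set"
  have W: "subspace ?W" by (intro subspace_Times subspace_Vh_vec)
  obtain B where B: "finite B" "independent B" "span B = ?W"
    using finite_basis_Vh_vec_pairs[OF mesh] by blast
  have "\<exists>u\<in>?W. \<forall>v\<in>?W. scheme_form \<Delta>t xh zh u v = scheme_load \<Delta>t xm xh v"
    by (rule nondegenerate_form_solvable[OF B])
       (fact scheme_form_add_left scheme_form_scale_left scheme_form_add_right scheme_form_scale_right
          scheme_load_add[OF xm] scheme_load_scale scheme_form_nondegenerate[OF dt nonzero])+
  then obtain u where u: "u \<in> ?W" "\<forall>v\<in>?W. scheme_form \<Delta>t xh zh u v = scheme_load \<Delta>t xm xh v"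
    by blast
  show ?thesis
  proof (rule ex1I)
    show "u \<in> ?W \<and> (\<forall>v\<in>?W. scheme_form \<Delta>t xh zh u v = scheme_load \<Delta>t xm xh v)"
      using u by blast
    fix p assume p: "p \<in> ?W \<and> (\<forall>v\<in>?W. scheme_form \<Delta>t xh zh p v = scheme_load \<Delta>t xm xh v)"
    have mu: "(- 1) *\<^sub>R u \<in> ?W" using subspace_scale[OF W u(1)] .
    have "p + (- 1) *\<^sub>R u = 0"
    proof (rule scheme_form_nondegenerate[OF dt nonzero])
      show "p + (- 1) *\<^sub>R u \<in> ?W" using subspace_add[OF W _ mu] p by blast
      fix v assume v: "v \<in> ?W"
      have "scheme_form \<Delta>t xh zh (p + (- 1) *\<^sub>R u) v
          = scheme_form \<Delta>t xh zh p v + (- 1) * scheme_form \<Delta>t xh zh u v"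
        using scheme_form_add_left[OF conjunct1[OF p] mu v] scheme_form_scale_left[OF u(1) v] by metis
      then show "scheme_form \<Delta>t xh zh (p + (- 1) *\<^sub>R u) v = 0" using p u(2) v by simp
    qed
    then show "p = u" by simp
  qed
qed

end

theorem theorem4p1:
  fixes J :: nat and \<rho> :: "nat \<Rightarrow> real" and c \<Delta>t :: real
    and xm xh zh :: "real \<Rightarrow> real ^ 'n"
  assumes "CARD('n) \<ge> 2"
    and "J \<ge> 3" and "mesh J \<rho>" and "mesh_regular c J \<rho>"
    and "\<Delta>t > 0"
    and "xm \<in> Vh_vec J \<rho>" and "xh \<in> Vh_vec J \<rho>" and "zh \<in> Vh_vec J \<rho>"
    and "\<forall>j\<in>{1..J}. \<forall>s\<in>{\<rho> (j - 1)<..<\<rho> j}. norm (drho xh s) > 0"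
  shows "(\<exists>!p. scheme_solution J \<rho> \<Delta>t xm xh zh (fst p) (snd p)) \<and>
    (\<forall>xn yh. scheme_solution J \<rho> \<Delta>t xm xh zh xn yh \<longrightarrow>
       1/2 * (H1_seminorm xn)\<^sup>2
         + \<Delta>t * L2_inner (\<lambda>s. (norm (drho yh s + (zh s \<bullet> yh s) *\<^sub>R drho xh s))\<^sup>2) (\<lambda>s. 1)
       = 1/2 * (H1_seminorm xm)\<^sup>2)"
proof (intro conjI allI impI)
  have "scheme_solution J \<rho> \<Delta>t xm xh zh (fst p) (snd p) \<longleftrightarrow>
      p \<in> Vh_vec J \<rho> \<times> Vh_vec J \<rho> \<and>
      (\<forall>v\<in>Vh_vec J \<rho> \<times> Vh_vec J \<rho>. scheme_form \<Delta>t xh zh p v = scheme_load \<Delta>t xm xh v)" for p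
    using scheme_solution_iff_weak_form[OF assms(3,7,8,6), of \<Delta>t "fst p" "snd p"] by simp
  then show "\<exists>!p. scheme_solution J \<rho> \<Delta>t xm xh zh (fst p) (snd p)"
    using weak_form_uniquely_solvable[OF assms(3,7,8,5,6,9)] by simp
next
  fix xn yh assume "scheme_solution J \<rho> \<Delta>t xm xh zh xn yh"
  then show "1/2 * (H1_seminorm xn)\<^sup>2
         + \<Delta>t * L2_inner (\<lambda>s. (norm (drho yh s + (zh s \<bullet> yh s) *\<^sub>R drho xh s))\<^sup>2) (\<lambda>s. 1)
       = 1/2 * (H1_seminorm xm)\<^sup>2"
    by (rule energy_identity[OF assms(3,7,8,5,6)])
qed

end
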